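(* Phragmén's methods satisfy the following properties, where $V$ is the number of votes (ballots), $s$ is the number of seats, and $\ell$ is an arbitrary integer with $1\le \ell\le s$. (i) For Phragmén's unordered method: if a set of more than $\frac{\ell}{s+1}V$ voters vote for the same list (i.e. have the same ballot, a set of candidates) containing at least $\ell$ candidates, then at least $\ell$ candidates from this list are elected. (ii) For Phragmén's ordered method: if a set of more than $\frac{\ell}{s+1}V$ voters vote with the same $\ell$ candidates first on their ballots, but not necessarily in the same order (i.e. the set of the first $\ell$ names is the same on all these ballots), then these $\ell$ candidates are elected. In particular, if more than $\frac{\ell}{s+1}V$ voters vote for the same (ordered) list containing at least $\ell$ candidates, then the $\ell$ first candidates on this list will be elected.
   Context: There is a finite set of candidates and a finite multiset of $V$ ballots, one for each voter; $s$ candidates are to be elected, where $s$ is at most the number of candidates. An unordered ballot is a set of candidates; an ordered ballot is a list of distinct candidates in order. Ties are broken arbitrarily; the assertions hold for every possible outcome. Phragmén's unordered method: every ballot $b$ has a place number $r_b$, initially $0$. Seats are filled one by one until $s$ candidates have been elected. For each seat, each not yet elected candidate $i$ gets the reduced vote $W_i:=n_i/(1+\sum_{b\ni i} r_b)$, where the sum is over all ballots $b$ containing $i$ and $n_i$ is the number of these ballots. A candidate $i$ with the largest $W_i$ is elected, and then $r_b$ is replaced by $1/W_i$ for every ballot $b$ containing $i$ (other place numbers are unchanged). Phragmén's ordered method: every ballot $b$ has a place number $r_b$, initially $0$. Seats are filled one by one until $s$ candidates have been elected. For each seat, each ballot is counted only for its current top candidate, i.e. the first candidate on it that is not yet elected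 (ballots all of whose candidates are elected are ignored). For a not yet elected candidate $i$, let $B_i$ be the set of ballots currently counted for $i$; the reduced vote of $i$ is $W_i:=|B_i|/(1+\sum_{b\in B_i} r_b)$. A candidate $i$ with the largest $W_i$ is elected, and then $r_b$ is replaced by $1/W_i$ for all $b\in B_i$ (other place numbers are unchanged). *)

theory Defs
  imports Complex_Main
begin

text \<open>
  Voters are the elements of a finite set \<open>N\<close>, and \<open>B v\<close> is the ballot of voter \<open>v\<close>; this renders
  the multiset of ballots, and a place number \<open>r v\<close> is attached to each individual ballot.
  The state of a count consists of the set \<open>E\<close> of candidates elected so far and the place numbers.

  The two methods differ only in which ballots are counted for a candidate. This is the parameter
  \<open>S\<close>: the set \<open>S E i\<close> contains the voters whose ballots are counted for \<open>i\<close> when \<open>E\<close> is the set of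
  candidates already elected.
\<close>

definition reduced_vote :: "'v set \<Rightarrow> ('v \<Rightarrow> real) \<Rightarrow> real" where
  "reduced_vote X r = real (card X) / (1 + (\<Sum>v\<in>X. r v))"

text \<open>
  One seat is filled. Any candidate with maximal reduced vote may be chosen, so that the step is a
  relation. If the reduced vote of the chosen candidate is \<open>0\<close>, then no ballot is counted for
  that candidate, and the expression \<open>1 / W i\<close> is never used.
\<close>

definition phragmen_step ::
  "'c set \<Rightarrow> ('c set \<Rightarrow> 'c \<Rightarrow> 'v set) \<Rightarrow> 'c set \<times> ('v \<Rightarrow> real) \<Rightarrow> 'c set \<times> ('v \<Rightarrow> real) \<Rightarrow> bool" where
  "phragmen_step C S = (\<lambda>(E, r) (E', r').
     let W = (\<lambda>i. reduced_vote (S E i) r) in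
     \<exists>i \<in> C - E. (\<forall>j \<in> C - E. W j \<le> W i) \<and>
       E' = insert i E \<and>
       r' = (\<lambda>v. if v \<in> S E i then 1 / W i else r v))"

definition phragmen_outcome ::
  "'c set \<Rightarrow> ('c set \<Rightarrow> 'c \<Rightarrow> 'v set) \<Rightarrow> nat \<Rightarrow> 'c set \<Rightarrow> bool" where
  "phragmen_outcome C S s E \<longleftrightarrow> (\<exists>r. (phragmen_step C S ^^ s) ({}, \<lambda>v. 0) (E, r))"

definition unordered_outcome ::
  "'c set \<Rightarrow> 'v set \<Rightarrow> ('v \<Rightarrow> 'c set) \<Rightarrow> nat \<Rightarrow> 'c set \<Rightarrow> bool" where
  "unordered_outcome C N B = phragmen_outcome C (\<lambda>E i. {v \<in> N. i \<in> B v})"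

text \<open>The current top candidate; \<open>None\<close> if all candidates on the ballot are elected.\<close>

definition current_top :: "'c set \<Rightarrow> 'c list \<Rightarrow> 'c option" where
  "current_top E b = find (\<lambda>c. c \<notin> E) b"

definition ordered_outcome ::
  "'c set \<Rightarrow> 'v set \<Rightarrow> ('v \<Rightarrow> 'c list) \<Rightarrow> nat \<Rightarrow> 'c set \<Rightarrow> bool" where
  "ordered_outcome C N B = phragmen_outcome C (\<lambda>E i. {v \<in> N. current_top E (B v) = Some i})"

end

theory Submission
  imports Defs
begin

text \<open>
  Write \<open>t\<^sub>i = 1 / W\<^sub>i\<close>. If all place numbers are at most the largest one \<open>R\<close>, then
  \<open>R \<le> t\<^sub>j\<close> for every candidate \<open>j\<close> not yet elected, and this persists because the candidate with
  the least \<open>t\<^sub>i\<close> is elected and \<open>t\<^sub>i\<close> becomes the new \<open>R\<close>. Each election distributes exactly one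
  additional unit of place numbers. As long as the bloc \<open>M\<close> has an unelected
  candidate in \<open>P\<close>, the ballots of \<open>M\<close> receive place numbers from candidates in \<open>P\<close> only. If fewer
  than \<open>l\<close> of these are elected, then \<open>R \<le> t\<^sub>j\<close> for the remaining ones gives \<open>R |M| \<le> l\<close>, whence the
  total \<open>s\<close> of all place numbers is at most \<open>(l - 1) + (|N| - |M|) l / |M| = l |N| / |M| - 1 < s\<close>.
\<close>

text \<open>Common ground of the two methods: electing \<open>i\<close> may pass ballots counted for
  \<open>i\<close> on to other candidates, but takes no ballot away from a candidate still
  unelected. In the unordered method \<open>S\<close> ignores \<open>E\<close>, so
  \<open>S_mono\<close> and \<open>S_new\<close> are trivial.\<close>

locale phragmen_bloc =
  fixes C :: "'c set" and N :: "'v set" and S :: "'c set \<Rightarrow> 'c \<Rightarrow> 'v set"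
    and M :: "'v set" and P :: "'c set"
  assumes finite_N: "finite N" and finite_P: "finite P"
    and S_subset: "S E i \<subseteq> N"
    and S_mono: "j \<notin> insert i E \<Longrightarrow> S E j \<subseteq> S (insert i E) j"
    and S_new: "j \<notin> insert i E \<Longrightarrow> S (insert i E) j \<subseteq> S E j \<union> S E i"
    and M_subset: "M \<subseteq> N" and M_nonempty: "M \<noteq> {}"
    and M_votes_P: "\<not> P \<subseteq> E \<Longrightarrow> v \<in> M \<Longrightarrow> v \<in> S E i \<Longrightarrow> i \<in> P"
    and M_counted: "\<not> P \<subseteq> E \<Longrightarrow> v \<in> M \<Longrightarrow> \<exists>i\<in>C - E. v \<in> S E i"
begin

text \<open>The last clause is \<open>R\<close> \<le> \<open>1 / W j\<close> with the denominator
  cleared, so that it also makes sense when no ballot is counted for \<open>j\<close>.\<close>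

definition load_inv :: "nat \<Rightarrow> 'c set \<Rightarrow> ('v \<Rightarrow> real) \<Rightarrow> bool" where
  "load_inv n E r \<longleftrightarrow> (\<forall>v. 0 \<le> r v) \<and> (\<Sum>v\<in>N. r v) = real n \<and>
     (\<Sum>v\<in>M. r v) \<le> real (card (P \<inter> E)) \<and>
     (\<exists>R\<ge>0. (\<forall>v\<in>N. r v \<le> R) \<and>
        (\<forall>j\<in>C - E. R * real (card (S E j)) \<le> 1 + (\<Sum>v\<in>S E j. r v)))"

lemma finite_S: "finite (S E i)"
  using S_subset finite_N by (rule finite_subset)

lemma finite_M: "finite M"
  using M_subset finite_N by (rule finite_subset)

lemma load_inv_step:
  assumes inv: "load_inv n E r" and step: "phragmen_step C S (E, r) (E', r')"
    and notP: "\<not> P \<subseteq> E"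
  shows "load_inv (Suc n) E' r'"
proof -
  define W where "W i = reduced_vote (S E i) r" for i
  obtain i where i: "i \<in> C - E" and max: "\<And>j. j \<in> C - E \<Longrightarrow> W j \<le> W i"
    and E': "E' = insert i E" and r': "r' = (\<lambda>v. if v \<in> S E i then 1 / W i else r v)"
    using step unfolding phragmen_step_def Let_def W_def by auto
  obtain R where r0: "\<And>v. 0 \<le> r v" and sumN: "(\<Sum>v\<in>N. r v) = real n"
    and sumM: "(\<Sum>v\<in>M. r v) \<le> real (card (P \<inter> E))" and R0: "0 \<le> R"
    and rR: "\<And>v. v \<in> N \<Longrightarrow> r v \<le> R"
    and Rj: "\<And>j. j \<in> C - E \<Longrightarrow> R * real (card (S E j)) \<le> 1 + (\<Sum>v\<in>S E j. r v)"
    using inv unfolding load_inv_def by blast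
  have den: "1 + (\<Sum>v\<in>X. r v) > 0" for X
    using sum_nonneg[of X r] r0 by (simp add: add_pos_nonneg)
  \<comment> \<open>A ballot of \<open>M\<close> is counted for some eligible candidate, so the
    maximal reduced vote is positive and \<open>1 / W i\<close> is a true reciprocal.\<close>
  obtain v0 where "v0 \<in> M" using M_nonempty by blast
  then obtain k where k: "k \<in> C - E" "v0 \<in> S E k" using M_counted[OF notP] by blast
  have "card (S E k) > 0" using k(2) finite_S[of E k] by (auto simp: card_gt_0_iff)
  then have "W k > 0" unfolding W_def reduced_vote_def using den by simp
  with max[OF k(1)] have Wpos: "W i > 0" by linarith
  define t where "t = 1 / W i"
  have t0: "t > 0" using Wpos by (simp add: t_def)
  have r't: "r' v = (if v \<in> S E i then t else r v)" for v
    by (simp add: r' t_def)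
  have "card (S E i) \<noteq> 0"
    using Wpos by (intro notI) (simp add: W_def reduced_vote_def)
  then have cardpos: "real (card (S E i)) > 0" by simp
  have tX: "t * real (card (S E i)) = 1 + (\<Sum>v\<in>S E i. r v)"
    using cardpos by (simp add: t_def W_def reduced_vote_def)
  have tj: "t * real (card (S E j)) \<le> 1 + (\<Sum>v\<in>S E j. r v)" if "j \<in> C - E" for j
    using max[OF that] Wpos den[of "S E j"] unfolding t_def
    by (simp add: W_def[of j] reduced_vote_def field_simps)
  \<comment> \<open>The old invariant at the elected candidate itself shows that the bound grows
    from \<open>R\<close> to \<open>t\<close>; hence no place number decreases.\<close>
  have "R * real (card (S E i)) \<le> t * real (card (S E i))"
    using Rj[OF i] tX by simp
  then have Rt: "R \<le> t" using cardpos by simp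
  have incr: "r v \<le> r' v" if "v \<in> N" for v
    using rR[OF that] Rt by (simp add: r't)
  have "(\<Sum>v\<in>N. r' v - r v) = (\<Sum>v\<in>S E i. t - r v)"
    using finite_N S_subset[of E i]
    by (intro sum.mono_neutral_cong_right) (auto simp: r't)
  also have "\<dots> = 1"
    using tX by (simp add: sum_subtractf mult.commute)
  finally have unit: "(\<Sum>v\<in>N. r' v - r v) = 1" .
  have sumN': "(\<Sum>v\<in>N. r' v) = real (Suc n)"
    using unit sumN by (simp add: sum_subtractf)
  have sumM': "(\<Sum>v\<in>M. r' v) \<le> real (card (P \<inter> E'))"
  proof (cases "i \<in> P")
    case True
    have "(\<Sum>v\<in>M. r' v - r v) \<le> (\<Sum>v\<in>N. r' v - r v)"
      using finite_N M_subset incr by (intro sum_mono2) auto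
    then have "(\<Sum>v\<in>M. r' v) \<le> real (card (P \<inter> E)) + 1"
      using unit sumM by (simp add: sum_subtractf)
    moreover have "card (P \<inter> E') = Suc (card (P \<inter> E))"
      using True i finite_P by (simp add: E')
    ultimately show ?thesis by simp
  next
    case False
    then have "(\<Sum>v\<in>M. r' v) = (\<Sum>v\<in>M. r v)"
      using M_votes_P[OF notP] by (intro sum.cong) (auto simp: r't)
    then show ?thesis using False sumM by (simp add: E')
  qed
  have tj': "t * real (card (S E' j)) \<le> 1 + (\<Sum>v\<in>S E' j. r' v)" if "j \<in> C - E'" for j
  proof -
    have jE: "j \<in> C - E" "j \<notin> insert i E" using that by (auto simp: E')
    have sub: "S E j \<subseteq> S E' j" and new: "S E' j - S E j \<subseteq> S E i"
      using S_mono[OF jE(2)] S_new[OF jE(2)] by (auto simp: E')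
    \<comment> \<open>Ballots newly counted for \<open>j\<close> come from \<open>i\<close> and have
      just received the value \<open>t\<close>, so they contribute zero to the sum of
      \<open>r' v - t\<close>.\<close>
    have "(\<Sum>v\<in>S E' j. r' v - t) = (\<Sum>v\<in>S E j. r' v - t)"
      using finite_S sub new by (intro sum.mono_neutral_right) (auto simp: r't)
    moreover have "(\<Sum>v\<in>S E j. r v) \<le> (\<Sum>v\<in>S E j. r' v)"
      using incr S_subset by (intro sum_mono) blast
    ultimately show ?thesis
      using tj[OF jE(1)] by (simp add: sum_subtractf mult.commute)
  qed
  have "\<forall>v. 0 \<le> r' v" using r0 t0 by (simp add: r't)
  moreover have "\<forall>v\<in>N. r' v \<le> t" using rR Rt by (force simp: r't)
  ultimately show ?thesis
    unfolding load_inv_def using sumN' sumM' tj' t0 by (metis less_imp_le)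
qed

text \<open>Elected sets only grow, so a member of \<open>P\<close> missing at the end was missing
  at every step.\<close>

lemma load_inv_run:
  assumes "(phragmen_step C S ^^ n) ({}, \<lambda>v. 0) (E, r)" and "\<not> P \<subseteq> E"
  shows "load_inv n E r"
  using assms
proof (induction n arbitrary: E r)
  case 0
  then show ?case by (auto simp: load_inv_def intro!: exI[of _ 0])
next
  case (Suc n)
  from Suc.prems(1) obtain E0 r0 where run: "(phragmen_step C S ^^ n) ({}, \<lambda>v. 0) (E0, r0)"
    and step: "phragmen_step C S (E0, r0) (E, r)"
    by (metis relpowp_Suc_E surj_pair)
  have "E0 \<subseteq> E" using step unfolding phragmen_step_def Let_def by auto
  with Suc.prems(2) have "\<not> P \<subseteq> E0" by blast
  then show ?case using load_inv_step[OF Suc.IH[OF run] step] by blast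
qed

text \<open>\<open>D\<close> consists of unelected candidates that share out the ballots of
  \<open>M\<close>: a single candidate in the unordered method, all of \<open>P - E\<close> in the
  ordered one.\<close>

lemma bloc_bound:
  assumes out: "phragmen_outcome C S s E" and notP: "\<not> P \<subseteq> E"
    and D: "finite D" "D \<subseteq> C - E" "M \<subseteq> (\<Union>j\<in>D. S E j)"
    and disj: "\<And>i j. i \<in> D \<Longrightarrow> j \<in> D \<Longrightarrow> i \<noteq> j \<Longrightarrow> S E i \<inter> S E j = {}"
    and l: "card D + card (P \<inter> E) \<le> l"
  shows "real (card M) \<le> real l / (real s + 1) * real (card N)"
proof -
  obtain r where "(phragmen_step C S ^^ s) ({}, \<lambda>v. 0) (E, r)"
    using out unfolding phragmen_outcome_def by blast
  from load_inv_run[OF this notP] obtain R where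
    sumN: "(\<Sum>v\<in>N. r v) = real s" and sumM: "(\<Sum>v\<in>M. r v) \<le> real (card (P \<inter> E))"
    and R0: "0 \<le> R" and rR: "\<And>v. v \<in> N \<Longrightarrow> r v \<le> R"
    and Rj: "\<And>j. j \<in> C - E \<Longrightarrow> R * real (card (S E j)) \<le> 1 + (\<Sum>v\<in>S E j. r v)"
    unfolding load_inv_def by blast
  \<comment> \<open>Outside \<open>M\<close> each place number is estimated by \<open>R\<close>.
    This serves twice, for \<open>X = U\<close> and for \<open>X = N\<close>.\<close>
  have outside: "(\<Sum>v\<in>X. r v) \<le> real (card (P \<inter> E)) + R * (real (card X) - real (card M))"
    if "M \<subseteq> X" "X \<subseteq> N" for X
  proof -
    have X: "finite X" using that finite_N finite_subset by blast
    have "(\<Sum>v\<in>X - M. r v) \<le> (\<Sum>v\<in>X - M. R)"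
      using rR that by (intro sum_mono) blast
    also have "\<dots> = R * (real (card X) - real (card M))"
      using that X by (simp add: card_Diff_subset finite_M card_mono of_nat_diff)
    finally show ?thesis
      using sumM sum.subset_diff[OF that(1) X, of r] by simp
  qed
  define U where "U = (\<Union>j\<in>D. S E j)"
  have U: "M \<subseteq> U" "U \<subseteq> N" using D(3) S_subset by (auto simp: U_def)
  have cardU: "card U = (\<Sum>j\<in>D. card (S E j))"
    unfolding U_def using D(1) finite_S disj by (intro card_UN_disjoint) auto
  have sumU: "(\<Sum>v\<in>U. r v) = (\<Sum>j\<in>D. \<Sum>v\<in>S E j. r v)"
    unfolding U_def using D(1) finite_S disj by (intro sum.UNION_disjoint) auto
  \<comment> \<open>Adding the inequalities over \<open>D\<close> and applying
    \<open>outside\<close> cancels \<open>R * card U\<close> and leaves a bound on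
    \<open>R * card M\<close>.\<close>
  have "R * real (card U) = (\<Sum>j\<in>D. R * real (card (S E j)))"
    by (simp add: cardU sum_distrib_left)
  also have "\<dots> \<le> (\<Sum>j\<in>D. 1 + (\<Sum>v\<in>S E j. r v))"
    using Rj D(2) by (intro sum_mono) blast
  also have "\<dots> = real (card D) + (\<Sum>v\<in>U. r v)"
    by (simp add: sum.distrib sumU)
  finally have "R * real (card M) \<le> real (card D + card (P \<inter> E))"
    using outside[OF U] by (simp add: algebra_simps)
  then have RM: "R * real (card M) \<le> real l" using l by linarith
  \<comment> \<open>At least one unit of \<open>l\<close> is used by \<open>D\<close>; this is what
    turns \<open>s\<close> into \<open>s + 1\<close> below.\<close>
  have "D \<noteq> {}" using D(3) M_nonempty by auto
  then have "card D > 0" using D(1) by (simp add: card_gt_0_iff)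
  then have "card (P \<inter> E) + 1 \<le> l" using l by linarith
  then have "real (card (P \<inter> E)) \<le> real l - 1" by linarith
  then have "real s + 1 \<le> real l + R * (real (card N) - real (card M))"
    using outside[OF M_subset] sumN by simp
  then have "(real s + 1) * real (card M)
      \<le> (real l + R * (real (card N) - real (card M))) * real (card M)"
    by (intro mult_right_mono) auto
  also have "\<dots> = real l * real (card M)
      + (R * real (card M)) * (real (card N) - real (card M))"
    by (simp add: algebra_simps)
  also have "\<dots> \<le> real l * real (card M) + real l * (real (card N) - real (card M))"
    using RM card_mono[OF finite_N M_subset] by (intro add_left_mono mult_right_mono) auto
  finally show ?thesis by (simp add: field_simps)
qed

end

lemma current_top_insert:
  assumes "current_top E b = Some j" and "j \<noteq> i"
  shows "current_top (insert i E) b = Some j"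
  using assms unfolding current_top_def by (induction b) (auto split: if_splits)

lemma current_top_insertD:
  assumes "current_top (insert i E) b = Some j"
  shows "current_top E b = Some j \<or> current_top E b = Some i"
  using assms unfolding current_top_def by (induction b) (auto split: if_splits)

text \<open>Keeps the ballots of an ordered bloc with its first \<open>l\<close> names until all of
  these are elected; it gives \<open>M_votes_P\<close> and \<open>M_counted\<close>.\<close>

lemma current_top_take:
  assumes "\<not> set (take l b) \<subseteq> E"
  shows "\<exists>i\<in>set (take l b) - E. current_top E b = Some i"
  using assms unfolding current_top_def
proof (induction b arbitrary: l)
  case (Cons a b)
  then show ?case by (cases l) auto
qed simp

text \<open>If fewer than \<open>l\<close> members of \<open>A\<close> were elected, one unelected
  \<open>i\<close> in \<open>A\<close> would be on every ballot of \<open>M\<close>, so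
  \<open>bloc_bound\<close> with \<open>D = {i}\<close> would contradict the size of
  \<open>M\<close>.\<close>

lemma unordered_bloc:
  fixes B :: "'v \<Rightarrow> 'c set"
  assumes "finite C" and "finite N" and ballots: "\<forall>v\<in>N. B v \<subseteq> C"
    and out: "unordered_outcome C N B s E" and "M \<subseteq> N"
    and large: "real (card M) > real l / (real s + 1) * real (card N)"
    and A: "\<forall>v\<in>M. B v = A" and "l \<le> card A"
  shows "l \<le> card (A \<inter> E)"
proof (rule ccontr)
  assume less: "\<not> l \<le> card (A \<inter> E)"
  have "0 \<le> real l / (real s + 1) * real (card N)" by simp
  then have "real (card M) > 0" using large by linarith
  then have "M \<noteq> {}" by auto
  then have "A \<subseteq> C" using ballots A \<open>M \<subseteq> N\<close> by blast
  then have "finite A" using \<open>finite C\<close> finite_subset by blast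
  have notA: "\<not> A \<subseteq> E" using less \<open>l \<le> card A\<close> by (auto simp: Int_absorb2)
  then obtain i where i: "i \<in> A" "i \<notin> E" by blast
  interpret phragmen_bloc C N "\<lambda>E i. {v \<in> N. i \<in> B v}" M A
  proof unfold_locales
    show "\<exists>i\<in>C - E. v \<in> {v \<in> N. i \<in> B v}" if "\<not> A \<subseteq> E" "v \<in> M" for E v
      using that A \<open>A \<subseteq> C\<close> \<open>M \<subseteq> N\<close> by blast
  qed (use \<open>finite N\<close> \<open>finite A\<close> \<open>M \<subseteq> N\<close> \<open>M \<noteq> {}\<close> A in auto)
  have "real (card M) \<le> real l / (real s + 1) * real (card N)"
    using out i \<open>A \<subseteq> C\<close> \<open>M \<subseteq> N\<close> A less notA
    by (intro bloc_bound[where D = "{i}"]) (auto simp: unordered_outcome_def)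
  then show False using large by simp
qed

text \<open>Here the bloc may be split among several current tops. The choice
  \<open>D = P - E\<close> covers it, the counted sets are disjoint because a ballot has only one
  top, and \<open>card D + card (P \<inter> E) = card P\<close> \<le> \<open>l\<close>.\<close>

lemma ordered_bloc:
  fixes B :: "'v \<Rightarrow> 'c list"
  assumes "finite N" and ballots: "\<forall>v\<in>N. set (B v) \<subseteq> C"
    and out: "ordered_outcome C N B s E" and "M \<subseteq> N"
    and large: "real (card M) > real l / (real s + 1) * real (card N)"
    and P: "\<forall>v\<in>M. set (take l (B v)) = P"
  shows "P \<subseteq> E"
proof (rule ccontr)
  assume notP: "\<not> P \<subseteq> E"
  have "0 \<le> real l / (real s + 1) * real (card N)" by simp
  then have "real (card M) > 0" using large by linarith
  then have "M \<noteq> {}" by auto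
  then obtain v where v: "v \<in> M" by blast
  then have P_v: "P = set (take l (B v))" using P by simp
  then have "finite P" by simp
  have "P \<subseteq> C" using P_v v ballots \<open>M \<subseteq> N\<close> set_take_subset[of l "B v"] by blast
  have "card P \<le> l" using card_length[of "take l (B v)"] by (simp add: P_v)
  have top: "\<exists>i\<in>P - E. current_top E (B v) = Some i" if "v \<in> M" "\<not> P \<subseteq> E" for v E
    using current_top_take[of l "B v" E] P that by auto
  interpret phragmen_bloc C N "\<lambda>E i. {v \<in> N. current_top E (B v) = Some i}" M P
  proof unfold_locales
    show "\<And>E v. \<not> P \<subseteq> E \<Longrightarrow> v \<in> M
        \<Longrightarrow> \<exists>i\<in>C - E. v \<in> {v \<in> N. current_top E (B v) = Some i}"
      using top \<open>P \<subseteq> C\<close> \<open>M \<subseteq> N\<close> by blast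
    show "\<And>E v i. \<not> P \<subseteq> E \<Longrightarrow> v \<in> M
        \<Longrightarrow> v \<in> {v \<in> N. current_top E (B v) = Some i} \<Longrightarrow> i \<in> P"
      using top by fastforce
    show "{v \<in> N. current_top E (B v) = Some j}
        \<subseteq> {v \<in> N. current_top (insert i E) (B v) = Some j}" if "j \<notin> insert i E" for i j E
      using that by (auto simp: current_top_insert)
    show "{v \<in> N. current_top (insert i E) (B v) = Some j}
        \<subseteq> {v \<in> N. current_top E (B v) = Some j} \<union> {v \<in> N. current_top E (B v) = Some i}"
      for i j E
      using current_top_insertD by fastforce
  qed (use \<open>finite N\<close> \<open>finite P\<close> \<open>M \<subseteq> N\<close> \<open>M \<noteq> {}\<close> in simp_all)
  have "card (P - E) + card (P \<inter> E) = card P"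
    using card_Int_Diff[OF \<open>finite P\<close>, of E] by simp
  then have "real (card M) \<le> real l / (real s + 1) * real (card N)"
    using out \<open>finite P\<close> \<open>P \<subseteq> C\<close> \<open>card P \<le> l\<close> \<open>M \<subseteq> N\<close> top[OF _ notP] notP
    by (intro bloc_bound[where D = "P - E"]) (auto simp: ordered_outcome_def)
  then show False using large by simp
qed

theorem theorem16p1:
  fixes C :: "'c set" and N :: "'v set" and s l :: nat
  assumes "finite C" and "finite N" and "s \<le> card C" and "1 \<le> l" and "l \<le> s"
  shows
    "(\<forall>(B :: 'v \<Rightarrow> 'c set) E M A.
        (\<forall>v\<in>N. B v \<subseteq> C) \<longrightarrow> unordered_outcome C N B s E \<longrightarrow>
        M \<subseteq> N \<longrightarrow> real (card M) > real l / (real s + 1) * real (card N) \<longrightarrow>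
        (\<forall>v\<in>M. B v = A) \<longrightarrow> l \<le> card A \<longrightarrow>
        l \<le> card (A \<inter> E)) \<and>
     (\<forall>(B :: 'v \<Rightarrow> 'c list) E M.
        (\<forall>v\<in>N. distinct (B v) \<and> set (B v) \<subseteq> C) \<longrightarrow> ordered_outcome C N B s E \<longrightarrow>
        M \<subseteq> N \<longrightarrow> real (card M) > real l / (real s + 1) * real (card N) \<longrightarrow>
        (\<forall>P. (\<forall>v\<in>M. l \<le> length (B v) \<and> set (take l (B v)) = P) \<longrightarrow> P \<subseteq> E) \<and>
        (\<forall>L. (\<forall>v\<in>M. B v = L) \<longrightarrow> l \<le> length L \<longrightarrow> set (take l L) \<subseteq> E))"
proof (intro conjI allI impI)
  fix B :: "'v \<Rightarrow> 'c set" and E M A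
  assume "\<forall>v\<in>N. B v \<subseteq> C" "unordered_outcome C N B s E" "M \<subseteq> N"
    "real (card M) > real l / (real s + 1) * real (card N)" "\<forall>v\<in>M. B v = A" "l \<le> card A"
  then show "l \<le> card (A \<inter> E)"
    using unordered_bloc[OF assms(1,2)] by blast
next
  fix B :: "'v \<Rightarrow> 'c list" and E M P
  assume "\<forall>v\<in>N. distinct (B v) \<and> set (B v) \<subseteq> C" "ordered_outcome C N B s E" "M \<subseteq> N"
    "real (card M) > real l / (real s + 1) * real (card N)"
    "\<forall>v\<in>M. l \<le> length (B v) \<and> set (take l (B v)) = P"
  then show "P \<subseteq> E"
    by (intro ordered_bloc[OF assms(2), of B C s E M l P]) auto
next
  fix B :: "'v \<Rightarrow> 'c list" and E M L
  assume "\<forall>v\<in>N. distinct (B v) \<and> set (B v) \<subseteq> C" "ordered_outcome C N B s E" "M \<subseteq> N"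
    "real (card M) > real l / (real s + 1) * real (card N)" "\<forall>v\<in>M. B v = L"
  \<comment> \<open>A common list is the case \<open>P = set (take l L)\<close>.\<close>
  then show "set (take l L) \<subseteq> E"
    by (intro ordered_bloc[OF assms(2), of B C s E M l]) auto
qed

end
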